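(* Set $\mathrm{Wealth}_1=1$ and let $F:\mathbb{R}^d\to\mathbb{R}$ be a $1$-Lipschitz convex function, and let $F_-$ be a lower bound to the value of $F$. Define $\boldsymbol{\theta}_1=\boldsymbol{0}\in\mathbb{R}^d$, $H_1=1$, and $\boldsymbol{g}_t\in\partial F(\boldsymbol{x}_t)$ for $t=1,\dots,T$. Then the limit as $\delta$ approaches $0$ of running the coin-betting update (described in the context) over $1/\delta$ updates with the surrogate functions $\delta\tilde F_t$, where $\tilde F_t(\boldsymbol{x})=\max[F(\boldsymbol{x}_t)+\langle\boldsymbol{g}_t,\boldsymbol{x}-\boldsymbol{x}_t\rangle,\,F_-]$, gives the update rule $$\boldsymbol{x}_{t+1}=\boldsymbol{\psi}(t,h_t),$$ where $$\boldsymbol{\psi}(t,h):=\frac{\mathrm{Wealth}_t\,\exp\!\left(-\langle \boldsymbol{g}_t,\boldsymbol{\theta}_t\rangle \ln\!\left(1+\frac{h}{H_t}\right)+\|\boldsymbol{g}_t\|^2\left(h+H_t\ln\frac{H_t}{H_t+h}\right)\right)}{H_t+h}\,\bigl(\boldsymbol{\theta}_t-h\,\boldsymbol{g}_t\bigr),\qquad h_t:=\min(\tilde h_t,1),$$ the following quantities are defined recursively as $$\boldsymbol{\theta}_{t+1}:=\boldsymbol{\theta}_t-h_t\,\boldsymbol{g}_t,\qquad H_{t+1}:=H_t+h_t,$$ $$\mathrm{Wealth}_{t+1}:=\mathrm{Wealth}_t\,\exp\!\left(-\langle \boldsymbol{g}_t,\boldsymbol{\theta}_t\rangle \ln\!\left(1+\frac{h_t}{H_t}\right)+\|\boldsymbol{g}_t\|^2\left(h_t+H_t\ln\frac{H_t}{H_t+h_t}\right)\right),$$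 and $\tilde h_t$ is the zero of the function $$\phi(h):=F(\boldsymbol{x}_t)+\langle \boldsymbol{g}_t,\boldsymbol{\psi}(t,h)-\boldsymbol{x}_t\rangle-F_-.$$
   Context: Here $\|\cdot\|$ is the Euclidean norm on $\mathbb{R}^d$, $\langle\cdot,\cdot\rangle$ the inner product, $\partial F(\boldsymbol{x})$ the set of subgradients of $F$ at $\boldsymbol{x}$, and $\boldsymbol{1}[\cdot]$ the indicator of an event. Coin-betting update. Given past subgradients $\boldsymbol{g}_1,\dots,\boldsymbol{g}_t$ received at the points $\boldsymbol{x}_1,\dots,\boldsymbol{x}_t$, the update is $$\boldsymbol{x}_{t+1}=\frac{-\sum_{i=1}^t \boldsymbol{g}_i}{1+\sum_{i=1}^t \boldsymbol{1}[\boldsymbol{g}_i\ne \boldsymbol{0}]}\Bigl(1-\sum_{i=1}^t\langle \boldsymbol{g}_i,\boldsymbol{x}_i\rangle\Bigr).$$ The last factor is the wealth, the denominator is $H$ (one plus the count of non-zero subgradients), and the negative sum of subgradients is $\boldsymbol{\theta}$, so the point is $\frac{\mathrm{Wealth}}{H}\boldsymbol{\theta}$; in particular $\boldsymbol{x}_1=\boldsymbol{0}$. Mini-updates. Running this update over $1/\delta$ updates with the surrogate $\delta\tilde F_t$ means breaking the step from $\boldsymbol{x}_t$ to $\boldsymbol{x}_{t+1}$ into $1/\delta$ mini-updates of weight $\delta$, passing through points $\boldsymbol{x}_{t+\delta},\boldsymbol{x}_{t+2\delta},\dots,\boldsymbol{x}_{t+1-\delta},\boldsymbol{x}_{t+1}$,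 and starting from the state $(\mathrm{Wealth}_t,H_t,\boldsymbol{\theta}_t)$. At the point $\boldsymbol{x}_{t+j}$ the subgradient of $\tilde F_t$ that is used is $s_j\boldsymbol{g}_t$, where $s_j=\boldsymbol{1}[\tilde F_t(\boldsymbol{x}_{t+j})\neq F_-]$ (that is, $\boldsymbol{g}_t$, or the zero vector when $\tilde F_t(\boldsymbol{x}_{t+j})=F_-$). Each mini-update adds $-\delta s_j\langle\boldsymbol{g}_t,\boldsymbol{x}_{t+j}\rangle$ to the wealth, $-\delta s_j\boldsymbol{g}_t$ to $\boldsymbol{\theta}$, and $\delta s_j$ to $H$, and the next point is the current wealth divided by the current $H$, times the current $\boldsymbol{\theta}$. *)

theory Defs
  imports "HOL-Analysis.Analysis"
begin

definition subdifferential :: "('a::real_inner \<Rightarrow> real) \<Rightarrow> 'a \<Rightarrow> 'a set" where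
  "subdifferential F x = {g. \<forall>y. F x + g \<bullet> (y - x) \<le> F y}"

definition surrogate :: "('a::real_inner \<Rightarrow> real) \<Rightarrow> real \<Rightarrow> 'a \<Rightarrow> 'a \<Rightarrow> 'a \<Rightarrow> real" where
  "surrogate F Fm xt gt x = max (F xt + gt \<bullet> (x - xt)) Fm"

(* A state is a triple (Wealth, H, \<theta>). *)
type_synonym 'a cb_state = "real \<times> real \<times> 'a"

definition cb_point :: "'a::real_inner cb_state \<Rightarrow> 'a" where
  "cb_point S = (case S of (W, H, \<theta>) \<Rightarrow> (W / H) *\<^sub>R \<theta>)"

(* One coin-betting update of weight \<delta> on the surrogate Ft, whose subgradient at the current
   point x is s g: it is g where Ft x is different from the lower bound Fm, and 0 where
   Ft x = Fm.  The count H grows by \<delta> s, hence by \<delta> also if s = 1 and g = 0. *)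
definition mini_update ::
  "('a::real_inner \<Rightarrow> real) \<Rightarrow> real \<Rightarrow> 'a \<Rightarrow> real \<Rightarrow> 'a cb_state \<Rightarrow> 'a cb_state" where
  "mini_update Ft Fm g \<delta> S =
     (let x = cb_point S; s = of_bool (Ft x \<noteq> Fm) in
      case S of (W, H, \<theta>) \<Rightarrow> (W - \<delta> * s * (g \<bullet> x), H + \<delta> * s, \<theta> - (\<delta> * s) *\<^sub>R g))"

(* 1/\<delta> = N mini-updates of weight \<delta> = 1/N; the current point and subgradient at the
   beginning of the round determine the surrogate, which is kept during the round. *)
definition mini_run ::
  "('a::real_inner \<Rightarrow> real) \<Rightarrow> real \<Rightarrow> 'a \<Rightarrow> 'a \<Rightarrow> nat \<Rightarrow> 'a cb_state \<Rightarrow> 'a cb_state" where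
  "mini_run F Fm xt gt N = (mini_update (surrogate F Fm xt gt) Fm gt (1 / real N)) ^^ N"

definition wealth_after :: "real \<Rightarrow> real \<Rightarrow> 'a::real_inner \<Rightarrow> 'a \<Rightarrow> real \<Rightarrow> real" where
  "wealth_after W H \<theta> g h =
     W * exp (- (g \<bullet> \<theta>) * ln (1 + h / H) + (norm g)\<^sup>2 * (h + H * ln (H / (H + h))))"

definition psi :: "real \<Rightarrow> real \<Rightarrow> 'a::real_inner \<Rightarrow> 'a \<Rightarrow> real \<Rightarrow> 'a" where
  "psi W H \<theta> g h = (wealth_after W H \<theta> g h / (H + h)) *\<^sub>R (\<theta> - h *\<^sub>R g)"

definition phi ::
  "('a::real_inner \<Rightarrow> real) \<Rightarrow> real \<Rightarrow> 'a \<Rightarrow> real \<Rightarrow> real \<Rightarrow> 'a \<Rightarrow> 'a \<Rightarrow> real \<Rightarrow> real" where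
  "phi F Fm x W H \<theta> g h = F x + g \<bullet> (psi W H \<theta> g h - x) - Fm"

(* The zero of phi on [0, \<infinity>).  Along the iterates, phi has exactly one such zero if g \<noteq> 0 and
   F x > Fm.  If F x = Fm, then 0 is a zero but possibly not the only one, and the first zero
   is 0.  If g = 0 and F x > Fm, then phi is a positive constant and the value is \<infinity>. *)
definition phi_zero ::
  "('a::real_inner \<Rightarrow> real) \<Rightarrow> real \<Rightarrow> 'a \<Rightarrow> real \<Rightarrow> real \<Rightarrow> 'a \<Rightarrow> 'a \<Rightarrow> ereal" where
  "phi_zero F Fm x W H \<theta> g = Inf (ereal ` {h. 0 \<le> h \<and> phi F Fm x W H \<theta> g h = 0})"

(* The infimum is attained, so phi_zero is a zero of phi whenever there is one. *)
lemma phi_zero_is_zero: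
  assumes "H > 0" and "0 \<le> k" and "phi F Fm x W H \<theta> g k = 0"
  obtains h where "phi_zero F Fm x W H \<theta> g = ereal h" "0 \<le> h" "phi F Fm x W H \<theta> g h = 0"
    "\<And>h'. 0 \<le> h' \<Longrightarrow> phi F Fm x W H \<theta> g h' = 0 \<Longrightarrow> h \<le> h'"
proof -
  define Z where "Z = {h. 0 \<le> h \<and> phi F Fm x W H \<theta> g h = 0}"
  have pos: "H + h > 0" "1 + h / H > 0" if "h \<ge> 0" for h
    using that assms(1) by (simp_all add: add_pos_nonneg)
  have "continuous_on {0..} (phi F Fm x W H \<theta> g)"
    unfolding phi_def psi_def wealth_after_def
    using pos assms(1) by (intro continuous_intros) (fastforce simp: less_le)+
  then have "closed ({0..} \<inter> phi F Fm x W H \<theta> g -` {0})"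
    by (intro continuous_closed_preimage) auto
  also have "{0..} \<inter> phi F Fm x W H \<theta> g -` {0} = Z" by (auto simp: Z_def)
  finally have cl: "closed Z" .
  have ne: "Z \<noteq> {}" using assms by (auto simp: Z_def)
  have bdd: "bdd_below Z" unfolding Z_def by (rule bdd_belowI[of _ 0]) auto
  have mem: "Inf Z \<in> Z" using closed_contains_Inf[OF ne bdd cl] .
  have eq: "phi_zero F Fm x W H \<theta> g = ereal (Inf Z)"
    unfolding phi_zero_def Z_def[symmetric] using ereal_Inf'[OF bdd ne] by simp
  show ?thesis
    using that[OF eq] mem cInf_lower[OF _ bdd] by (auto simp: Z_def)
qed

end

theory Submission
  imports Defs
begin

text \<open>
  Within a round, the mini-updates without stopping are the explicit Euler method of step
  \<open>1 / N\<close> for \<open>V' = - (g \<bullet> (\<theta> - u g)) / (H + u) * V\<close>, whose solution is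
  \<open>wealth_after\<close>, and the convergence is uniform on \<open>[0, 1]\<close>. The actual run is the
  unstopped one, frozen from the first index \<open>m\<close> at which the surrogate equals the lower bound,
  so it remains to show \<open>m / N \<longlonglongrightarrow> h\<close>. This needs \<open>phi\<close> to change sign strictly at its
  first zero. It need not be monotone, but the sign of \<open>phi'\<close> is opposite to that of
  \<open>(g \<bullet> (\<theta> - u g))\<^sup>2 + g \<bullet> \<theta> + \<parallel>g\<parallel>\<^sup>2 H\<close>: this is positive throughout
  if \<open>g \<bullet> \<theta> \<ge> 0\<close> and \<open>g \<noteq> 0\<close>, and increasing in \<open>u\<close> if \<open>g \<bullet> \<theta> < 0\<close>, so that
  \<open>phi\<close> keeps decreasing once it has started to decrease.
\<close>

section \<open>Euler's method for a scalar linear differential equation\<close>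

text \<open>Uniform continuity of \<open>b u * V u\<close> bounds the fresh error of one step by
  \<open>\<eta> / N\<close>, and a step multiplies the inherited error by at most
  \<open>1 + B / N\<close>. So k steps accumulate at most \<open>k / N * \<eta>\<close> times
  \<open>(1 + B / N) ^ k\<close>, and that power stays below \<open>exp B\<close>.\<close>

lemma euler_linear_uniform:
  fixes b V :: "real \<Rightarrow> real"
  assumes b: "continuous_on {0..1} b"
    and V: "\<And>u. u \<in> {0..1} \<Longrightarrow> (V has_real_derivative b u * V u) (at u)"
    and e: "e > 0"
  shows "\<forall>\<^sub>F N in sequentially. \<forall>k\<le>N.
           \<bar>V 0 * (\<Prod>j<k. 1 + b (real j / real N) / real N) - V (real k / real N)\<bar> \<le> e"
proof -
  have "bounded (b ` {0..1})"
    using compact_continuous_image[OF b] compact_imp_bounded by auto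
  then obtain B where B: "B > 0" "\<And>u. u \<in> {0..1} \<Longrightarrow> \<bar>b u\<bar> \<le> B"
    unfolding bounded_pos by auto
  have contV: "continuous_on {0..1} V"
    using V by (meson DERIV_isCont continuous_at_imp_continuous_on)
  then have "uniformly_continuous_on {0..1} (\<lambda>u. b u * V u)"
    by (intro compact_uniformly_continuous continuous_intros b) auto
  \<comment> \<open>Chosen so that the accumulated amplification \<open>exp B\<close> brings the
    total error to \<open>e\<close>.\<close>
  moreover define \<eta> where "\<eta> = e / exp B"
  have \<eta>: "\<eta> > 0" using e by (simp add: \<eta>_def)
  ultimately obtain d where d: "d > 0"
    "\<And>u v. u \<in> {0..1} \<Longrightarrow> v \<in> {0..1} \<Longrightarrow> dist v u < d \<Longrightarrow> dist (b v * V v) (b u * V u) < \<eta>"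
    unfolding uniformly_continuous_on_def by metis
  have "\<forall>\<^sub>F N in sequentially. 1 / d < real N"
    using filterlim_at_top_dense[THEN iffD1, OF filterlim_real_sequentially] by blast
  then show ?thesis
  proof (rule eventually_mono, intro allI impI)
    fix N k :: nat
    assume Nd: "1 / d < real N" and "k \<le> N"
    define y where "y k = V 0 * (\<Prod>j<k. 1 + b (real j / real N) / real N)" for k
    have N: "real N > 0" using Nd d(1) by (meson divide_pos_pos less_trans zero_less_one)
    have dN: "1 / real N < d" using Nd d(1) N by (simp add: field_simps)
    have err: "k \<le> N \<Longrightarrow>
        \<bar>y k - V (real k / real N)\<bar> \<le> real k / real N * \<eta> * (1 + B / real N) ^ k" for k
    proof (induction k)
      case 0
      then show ?case by (simp add: y_def)
    next
      case (Suc k)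
      define u v where "u = real k / real N" and "v = real (Suc k) / real N"
      define q where "q = 1 + B / real N"
      have uv: "u < v" "v - u = 1 / real N" "0 \<le> u" "v \<le> 1"
        using N Suc.prems by (auto simp: u_def v_def field_simps)
      \<comment> \<open>The true increment uses the slope at some z between u and v, Euler's the
        slope at u; as \<open>v - u < d\<close>, the two slopes differ by less than
        \<open>\<eta>\<close>.\<close>
      obtain z where z: "z > u" "z < v" "V v - V u = (v - u) * (b z * V z)"
        using MVT2[of u v V "\<lambda>u. b u * V u"] uv V by force
      have "dist (b u * V u) (b z * V z) < \<eta>"
        using z uv dN by (intro d(2)) (auto simp: dist_real_def)
      then have loc: "\<bar>b u * V u - b z * V z\<bar> \<le> \<eta>" by (simp add: dist_real_def)
      have q1: "q \<ge> 1" using B(1) N by (simp add: q_def)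
      have "\<bar>1 + b u / real N\<bar> \<le> 1 + \<bar>b u\<bar> / real N"
        using N by (simp add: abs_triangle_ineq[of 1 "b u / real N", simplified abs_divide, simplified])
      also have "\<dots> \<le> q"
        using B(2)[of u] uv N by (simp add: q_def divide_right_mono)
      finally have bq: "\<bar>1 + b u / real N\<bar> \<le> q" .
      have IH: "\<bar>y k - V u\<bar> \<le> u * \<eta> * q ^ k"
        using Suc by (simp add: u_def q_def)
      have "V v = V u + b z * V z / real N" using z(3) uv(2) by (simp add: algebra_simps)
      then have "y (Suc k) - V v
          = (1 + b u / real N) * (y k - V u) + (b u * V u - b z * V z) / real N"
        by (simp add: y_def u_def[symmetric] algebra_simps diff_divide_distrib)
      also have "\<bar>\<dots>\<bar> \<le> \<bar>1 + b u / real N\<bar> * \<bar>y k - V u\<bar> + \<bar>b u * V u - b z * V z\<bar> / real N"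
        using N by (metis abs_mult abs_divide abs_of_pos abs_triangle_ineq)
      also have "\<dots> \<le> q * (u * \<eta> * q ^ k) + \<eta> / real N"
        using bq IH loc N q1 by (intro add_mono mult_mono divide_right_mono) auto
      \<comment> \<open>Enlarging the fresh error by \<open>q ^ Suc k\<close> gives both terms the
        same factor, and the times then add up: u + 1/N = v.\<close>
      also have "\<dots> \<le> q * (u * \<eta> * q ^ k) + \<eta> / real N * q ^ Suc k"
        using mult_left_mono[OF one_le_power[OF q1, of "Suc k"], of "\<eta> / real N"] \<eta> N
        by simp
      also have "\<dots> = v * \<eta> * q ^ Suc k"
        using uv(2) by (simp add: algebra_simps eq_diff_eq[symmetric])
      finally show ?case by (simp add: v_def q_def)
    qed
    have "\<bar>y k - V (real k / real N)\<bar> \<le> real k / real N * \<eta> * (1 + B / real N) ^ k"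
      using err \<open>k \<le> N\<close> .
    also have "\<dots> \<le> 1 * \<eta> * exp B"
    proof (intro mult_mono)
      have "(1 + B / real N) ^ k \<le> (1 + B / real N) ^ N"
        using \<open>k \<le> N\<close> B(1) N by (intro power_increasing) auto
      also have "\<dots> \<le> exp B"
        using exp_ge_one_plus_x_over_n_power_n[of N B] B(1) N by simp
      finally show "(1 + B / real N) ^ k \<le> exp B" .
    qed (use \<open>k \<le> N\<close> N \<eta> B(1) in auto)
    also have "\<dots> = e" by (simp add: \<eta>_def)
    finally show "\<bar>V 0 * (\<Prod>j<k. 1 + b (real j / real N) / real N) - V (real k / real N)\<bar> \<le> e"
      by (simp add: y_def)
  qed
qed

section \<open>The closed-form wealth and the derivative of \<open>phi\<close>\<close>

lemma wealth_after_0: "H > 0 \<Longrightarrow> wealth_after W H \<theta> g 0 = W"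
  by (simp add: wealth_after_def)

lemma wealth_after_pos: "W > 0 \<Longrightarrow> wealth_after W H \<theta> g u > 0"
  by (simp add: wealth_after_def)

text \<open>In the exponent, ln (1 + u/H) contributes 1/(H + u), and u + H ln (H/(H + u))
  contributes 1 - H/(H + u) = u/(H + u). Weighted by - g \<bullet> \<theta> and the squared norm of
  g, they combine into a single fraction.\<close>

lemma wealth_after_deriv:
  assumes "H > 0" "u \<ge> 0"
  shows "(wealth_after W H \<theta> g has_real_derivative
           - (g \<bullet> (\<theta> - u *\<^sub>R g)) / (H + u) * wealth_after W H \<theta> g u) (at u)"
proof -
  have Hu: "H + u > 0" using assms by simp
  have 1: "1 + u / H > 0" using assms by (simp add: add_pos_nonneg)
  have 2: "H / (H + u) > 0" using assms Hu by simp
  define E where "E = (\<lambda>h. - (g \<bullet> \<theta>) * ln (1 + h / H) + (norm g)\<^sup>2 * (h + H * ln (H / (H + h))))"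
  have "(E has_real_derivative
      - (g \<bullet> \<theta>) * (1 / H / (1 + u / H))
      + (norm g)\<^sup>2 * (1 + H * (- H / (H + u)\<^sup>2 / (H / (H + u))))) (at u)"
    unfolding E_def using Hu 1 2 assms
    by (auto intro!: derivative_eq_intros simp: power2_eq_square divide_simps)
  also have "- (g \<bullet> \<theta>) * (1 / H / (1 + u / H))
      + (norm g)\<^sup>2 * (1 + H * (- H / (H + u)\<^sup>2 / (H / (H + u))))
      = - (g \<bullet> (\<theta> - u *\<^sub>R g)) / (H + u)"
  proof -
    have "1 / H / (1 + u / H) = 1 / (H + u)" using assms Hu by (simp add: field_simps)
    moreover have "1 + H * (- H / (H + u)\<^sup>2 / (H / (H + u))) = u / (H + u)"
    proof -
      have "- H / (H + u)\<^sup>2 / (H / (H + u)) = - 1 / (H + u)"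
        using assms Hu by (simp add: power2_eq_square)
      then show ?thesis using Hu by (simp only:) (simp add: divide_simps)
    qed
    ultimately show ?thesis
      by (simp only:) (simp add: inner_diff_right power2_norm_eq_inner diff_divide_distrib)
  qed
  finally have "(E has_real_derivative - (g \<bullet> (\<theta> - u *\<^sub>R g)) / (H + u)) (at u)" .
  then have "((\<lambda>h. W * exp (E h)) has_real_derivative
      W * (exp (E u) * (- (g \<bullet> (\<theta> - u *\<^sub>R g)) / (H + u)))) (at u)"
    by (intro DERIV_cmult DERIV_fun_exp)
  moreover have "wealth_after W H \<theta> g = (\<lambda>h. W * exp (E h))"
    by (simp add: fun_eq_iff wealth_after_def E_def)
  ultimately show ?thesis by (simp add: mult_ac)
qed

text \<open>Put a = g \<bullet> (\<theta> - v g). Up to constants \<open>phi\<close> is V a / (H +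
  v), and V' = - a V / (H + v) turns its derivative into - V / (H + v)^2 times a^2 + a + n (H + v),
  where n is the squared norm of g.\<close>

lemma phi_deriv:
  assumes "H > 0" "u \<ge> 0"
  shows "(phi F Fm x W H \<theta> g has_real_derivative
           - (wealth_after W H \<theta> g u / (H + u)\<^sup>2
              * ((g \<bullet> (\<theta> - u *\<^sub>R g))\<^sup>2 + g \<bullet> \<theta> + (norm g)\<^sup>2 * H))) (at u)"
proof -
  have Hu: "H + u > 0" using assms by simp
  define n where "n = (norm g)\<^sup>2"
  define c where "c = g \<bullet> \<theta>"
  define V where "V = wealth_after W H \<theta> g"
  have a: "g \<bullet> (\<theta> - v *\<^sub>R g) = c - v * n" for v
    by (simp add: c_def n_def inner_diff_right power2_norm_eq_inner)
  have "phi F Fm x W H \<theta> g = (\<lambda>v. F x + V v / (H + v) * (c - v * n) - g \<bullet> x - Fm)"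
    by (simp add: fun_eq_iff phi_def psi_def inner_diff_right[of g _ x] a V_def)
  moreover define D where "D = - (c - u * n) / (H + u) * V u"
  have V: "(V has_real_derivative D) (at u)"
    using wealth_after_deriv[OF assms, of W \<theta> g] by (simp add: a V_def D_def)
  have "((\<lambda>v. F x + V v / (H + v) * (c - v * n) - g \<bullet> x - Fm) has_real_derivative
      (D * (H + u) - V u) / ((H + u) * (H + u)) * (c - u * n) - V u / (H + u) * n) (at u)"
    using Hu by (auto intro!: derivative_eq_intros V) (simp add: divide_simps, simp add: algebra_simps)
  moreover have "(- d / s * w * s - w) / (s * s) * d - w / s * n = - (w / s\<^sup>2 * (d\<^sup>2 + (d + n * s)))"
    if "s \<noteq> 0" for d s w
    using that by (simp add: field_simps power2_eq_square)
  from this[of "H + u" "c - u * n" "V u"]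
  have "(D * (H + u) - V u) / ((H + u) * (H + u)) * (c - u * n) - V u / (H + u) * n
      = - (V u / (H + u)\<^sup>2 * ((c - u * n)\<^sup>2 + (c - u * n + n * (H + u))))"
    using Hu unfolding D_def by simp
  \<comment> \<open>The two linear occurrences of u cancel, so only the square varies with u; the
    sign analysis of the derivative rests on this.\<close>
  moreover have "(c - u * n)\<^sup>2 + (c - u * n + n * (H + u)) = (c - u * n)\<^sup>2 + c + n * H"
    by (simp add: algebra_simps)
  ultimately show ?thesis by (simp only: a V_def c_def[symmetric] n_def[symmetric])
qed

section \<open>The sign of \<open>phi\<close> before and after its zero\<close>

lemma phi_0: "H > 0 \<Longrightarrow> phi F Fm (cb_point (W, H, \<theta>)) W H \<theta> g 0 = F (cb_point (W, H, \<theta>)) - Fm"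
  by (simp add: phi_def psi_def cb_point_def wealth_after_0)

lemma phi_continuous: "H > 0 \<Longrightarrow> continuous_on {0..} (phi F Fm x W H \<theta> g)"
  by (intro continuous_at_imp_continuous_on ballI DERIV_isCont[OF phi_deriv]) auto

text \<open>Falling from a positive value to 0 forces a negative derivative at some z before h.
  Beyond z the factor \<open>K\<close> stays positive, so \<open>phi\<close> is still strictly
  decreasing when it passes h.\<close>

lemma phi_neg_after_zero:
  assumes "H > 0" "W > 0" and start: "phi F Fm x W H \<theta> g 0 > 0"
    and "h \<ge> 0" and zero: "phi F Fm x W H \<theta> g h = 0" and "h < u"
  shows "phi F Fm x W H \<theta> g u < 0"
proof -
  define n where "n = (norm g)\<^sup>2"
  define c where "c = g \<bullet> \<theta>"
  define K where "K v = (g \<bullet> (\<theta> - v *\<^sub>R g))\<^sup>2 + g \<bullet> \<theta> + (norm g)\<^sup>2 * H" for v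
  define D where "D v = - (wealth_after W H \<theta> g v / (H + v)\<^sup>2 * K v)" for v
  have deriv: "v \<ge> 0 \<Longrightarrow> (phi F Fm x W H \<theta> g has_real_derivative D v) (at v)" for v
    using phi_deriv[OF assms(1)] by (simp add: D_def K_def)
  have K: "K v = (c - v * n)\<^sup>2 + c + n * H" for v
    by (simp add: K_def c_def n_def inner_diff_right power2_norm_eq_inner)
  have fac: "v \<ge> 0 \<Longrightarrow> wealth_after W H \<theta> g v / (H + v)\<^sup>2 > 0" for v
    using assms(1,2) by (simp add: wealth_after_pos)
  have "h > 0" using assms(4) start zero by (cases "h = 0") auto
  then obtain z where z: "0 < z" "z < h"
    "phi F Fm x W H \<theta> g h - phi F Fm x W H \<theta> g 0 = (h - 0) * D z"
    using MVT2[of 0 h _ D] deriv by force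
  have "h * D z < 0" using z(3) start zero by simp
  then have "D z < 0" using \<open>h > 0\<close> by (simp add: mult_less_0_iff)
  then have "wealth_after W H \<theta> g z / (H + z)\<^sup>2 * K z > 0"
    by (simp only: D_def neg_less_0_iff_less)
  then have "K z > 0" using zero_less_mult_pos fac[of z] z(1) by (metis less_imp_le)
  have Kv: "K v > 0" if "v > z" for v
  proof (cases "c \<ge> 0")
    case True
    \<comment> \<open>If g were 0, both n and c would vanish and \<open>K\<close> would be
      identically 0, against \<open>K z > 0\<close>. With n > 0 the constant part
      \<open>c + n * H\<close> is already positive.\<close>
    have "n \<noteq> 0 \<or> c \<noteq> 0" using \<open>K z > 0\<close> by (auto simp: K)
    then have "n > 0" by (auto simp: n_def c_def)
    then have "c + n * H > 0" using True assms(1) by (simp add: add_nonneg_pos)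
    then show ?thesis unfolding K using zero_le_power2[of "c - v * n"] by linarith
  next
    case False
    have "n \<ge> 0" by (simp add: n_def)
    then have "z * n \<le> v * n" "0 \<le> z * n" using that z(1) by (simp_all add: mult_right_mono)
    \<comment> \<open>Here \<open>c - v * n\<close> is negative and never moves back towards 0 as v
      grows.\<close>
    then have "(c - z * n)\<^sup>2 \<le> (c - v * n)\<^sup>2"
      using False by (intro abs_le_square_iff[THEN iffD1]) auto
    then show ?thesis using \<open>K z > 0\<close> by (simp add: K)
  qed
  obtain v where v: "h < v" "v < u"
    "phi F Fm x W H \<theta> g u - phi F Fm x W H \<theta> g h = (u - h) * D v"
    using MVT2[OF \<open>h < u\<close>, of "phi F Fm x W H \<theta> g" D] deriv assms(4) by auto
  have "D v < 0"
    unfolding D_def neg_less_0_iff_less using Kv[of v] fac[of v] v z by (intro mult_pos_pos) auto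
  then show ?thesis using v(3) zero \<open>h < u\<close> by (simp add: mult_pos_neg)
qed

lemma phi_pos_before_zero:
  assumes "H > 0" and start: "phi F Fm x W H \<theta> g 0 > 0" and "0 \<le> u"
    and nz: "\<And>v. 0 \<le> v \<Longrightarrow> v \<le> u \<Longrightarrow> phi F Fm x W H \<theta> g v \<noteq> 0"
  shows "phi F Fm x W H \<theta> g u > 0"
proof (rule ccontr)
  assume "\<not> ?thesis"
  moreover have "continuous_on {0..u} (phi F Fm x W H \<theta> g)"
    using phi_continuous[OF assms(1)] by (rule continuous_on_subset) auto
  ultimately obtain v where "0 \<le> v" "v \<le> u" "phi F Fm x W H \<theta> g v = 0"
    using IVT2'[of "phi F Fm x W H \<theta> g" u 0 0] start assms(3) by auto
  then show False using nz by blast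
qed

lemma phi_zero_nonneg: "0 \<le> phi_zero F Fm x W H \<theta> g"
  unfolding phi_zero_def by (rule Inf_greatest) auto

section \<open>Mini-updates as Euler steps up to a stopping index\<close>

text \<open>The state after k mini-updates that all use g. Since \<open>H\<close> and
  \<open>\<theta>\<close> then move linearly, the wealth recursion is linear, and its closed product
  has exactly the factors of \<open>euler_linear_uniform\<close>.\<close>

definition unstopped :: "'a::real_inner cb_state \<Rightarrow> 'a \<Rightarrow> nat \<Rightarrow> nat \<Rightarrow> 'a cb_state" where
  "unstopped S g N k = (case S of (W, H, \<theta>) \<Rightarrow>
     (W * (\<Prod>j<k. 1 + - (g \<bullet> (\<theta> - (real j / real N) *\<^sub>R g)) / (H + real j / real N) / real N),
      H + real k / real N, \<theta> - (real k / real N) *\<^sub>R g))"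

lemma mini_update_unstopped:
  assumes "Ft (cb_point (unstopped S g N k)) \<noteq> Fm"
  shows "mini_update Ft Fm g (1 / real N) (unstopped S g N k) = unstopped S g N (Suc k)"
proof -
  obtain W H \<theta> where S: "S = (W, H, \<theta>)" by (cases S)
  show ?thesis
    using assms
    by (simp add: mini_update_def Let_def S unstopped_def cb_point_def add_divide_distrib)
       (simp add: algebra_simps)
qed

lemma mini_update_stopped:
  assumes "Ft (cb_point S) = Fm"
  shows "mini_update Ft Fm g \<delta> S = S"
  using assms by (cases S) (simp add: mini_update_def Let_def)

text \<open>A state at which the surrogate equals \<open>Fm\<close> is a fixed point of the update,
  so a stopped run stays stopped. In the induction m either remains or, while nothing has stopped,
  advances together with k.\<close>

lemma mini_updates_stopping:
  "\<exists>m\<le>k. (mini_update Ft Fm g (1 / real N) ^^ k) S = unstopped S g N m \<and>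
     (\<forall>j<m. Ft (cb_point (unstopped S g N j)) \<noteq> Fm) \<and>
     (m < k \<longrightarrow> Ft (cb_point (unstopped S g N m)) = Fm)"
proof (induction k)
  case 0
  then show ?case by (auto simp: unstopped_def split: prod.splits)
next
  case (Suc k)
  then obtain m where m: "m \<le> k"
    "(mini_update Ft Fm g (1 / real N) ^^ k) S = unstopped S g N m"
    "\<forall>j<m. Ft (cb_point (unstopped S g N j)) \<noteq> Fm"
    "m < k \<longrightarrow> Ft (cb_point (unstopped S g N m)) = Fm" by blast
  show ?case
  proof (cases "Ft (cb_point (unstopped S g N m)) = Fm")
    case True
    then show ?thesis using m by (intro exI[of _ m]) (simp add: mini_update_stopped)
  next
    case False
    then have "m = k" using m by auto
    then show ?thesis using m False
      by (intro exI[of _ "Suc k"]) (auto simp: mini_update_unstopped less_Suc_eq)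
  qed
qed

section \<open>Uniform convergence of the unstopped run\<close>

lemma unstopped_wealth_uniform:
  assumes "H > 0" "e > 0"
  shows "\<forall>\<^sub>F N in sequentially. \<forall>k\<le>N.
           \<bar>fst (unstopped (W, H, \<theta>) g N k) - wealth_after W H \<theta> g (real k / real N)\<bar> \<le> e"
proof -
  have "continuous_on {0..1} (\<lambda>u. - (g \<bullet> (\<theta> - u *\<^sub>R g)) / (H + u))"
    using assms(1) by (intro continuous_intros) auto
  from euler_linear_uniform[OF this wealth_after_deriv[OF assms(1)] assms(2)]
  show ?thesis by (simp add: unstopped_def wealth_after_0[OF assms(1)])
qed

text \<open>The quantity that decides stopping is affine in the wealth, with a slope bounded for
  times in [0, 1], so the uniform wealth error carries over.\<close>

lemma unstopped_phi_uniform: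
  assumes "H > 0" "e > 0"
  shows "\<forall>\<^sub>F N in sequentially. \<forall>k\<le>N.
           \<bar>(F x + g \<bullet> (cb_point (unstopped (W, H, \<theta>) g N k) - x) - Fm)
             - phi F Fm x W H \<theta> g (real k / real N)\<bar> \<le> e"
proof -
  \<comment> \<open>Bounds the slope of the wealth; the summand 1 keeps \<open>C\<close> positive
    when g = 0, so that \<open>e / C\<close> is a legitimate tolerance.\<close>
  define C where "C = (\<bar>g \<bullet> \<theta>\<bar> + (norm g)\<^sup>2 + 1) / H"
  have "C > 0" using assms(1) by (simp add: C_def add_nonneg_pos)
  then have "e / C > 0" using assms(2) by simp
  from unstopped_wealth_uniform[OF assms(1) this, of W \<theta> g] show ?thesis
  proof (rule eventually_mono, intro allI impI)
    fix N k :: nat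
    assume *: "\<forall>k\<le>N. \<bar>fst (unstopped (W, H, \<theta>) g N k)
                 - wealth_after W H \<theta> g (real k / real N)\<bar> \<le> e / C" and "k \<le> N"
    define u where "u = real k / real N"
    define w where "w = fst (unstopped (W, H, \<theta>) g N k)"
    define V where "V = wealth_after W H \<theta> g u"
    define a where "a = g \<bullet> (\<theta> - u *\<^sub>R g)"
    have u: "0 \<le> u" "u \<le> 1" using \<open>k \<le> N\<close> by (auto simp: u_def divide_le_eq_1)
    have "\<bar>a\<bar> \<le> \<bar>g \<bullet> \<theta>\<bar> + \<bar>u * (norm g)\<^sup>2\<bar>"
      unfolding a_def inner_diff_right inner_scaleR_right power2_norm_eq_inner
      by (rule abs_triangle_ineq4)
    also have "\<bar>u * (norm g)\<^sup>2\<bar> \<le> (norm g)\<^sup>2"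
      using u by (simp add: abs_mult mult_left_le_one_le)
    finally have "\<bar>a / (H + u)\<bar> \<le> C"
      unfolding C_def abs_divide using u assms(1) by (intro frac_le) auto
    moreover have "cb_point (unstopped (W, H, \<theta>) g N k) = (w / (H + u)) *\<^sub>R (\<theta> - u *\<^sub>R g)"
      by (simp add: cb_point_def unstopped_def w_def u_def)
    then have "(F x + g \<bullet> (cb_point (unstopped (W, H, \<theta>) g N k) - x) - Fm)
        - phi F Fm x W H \<theta> g u = (w - V) * (a / (H + u))"
      by (simp add: phi_def psi_def V_def inner_diff_right[of g _ x] a_def[symmetric]
          left_diff_distrib diff_divide_distrib)
    moreover have "\<bar>w - V\<bar> \<le> e / C" using * \<open>k \<le> N\<close> by (simp add: w_def V_def u_def)
    ultimately have "\<bar>(F x + g \<bullet> (cb_point (unstopped (W, H, \<theta>) g N k) - x) - Fm)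
        - phi F Fm x W H \<theta> g u\<bar> \<le> e / C * C"
      by (simp only: abs_mult) (intro mult_mono, auto)
    then show "\<bar>(F x + g \<bullet> (cb_point (unstopped (W, H, \<theta>) g N k) - x) - Fm)
        - phi F Fm x W H \<theta> g (real k / real N)\<bar> \<le> e"
      using \<open>C > 0\<close> by (simp add: u_def)
  qed
qed

text \<open>The index \<open>m N\<close> changes with N, so the error bound has to be uniform in k;
  continuity of \<open>wealth_after\<close> at h does the rest.\<close>

lemma unstopped_tendsto:
  assumes "H > 0" "h \<ge> 0" and m: "\<And>N. m N \<le> N" and lim: "(\<lambda>N. real (m N) / real N) \<longlonglongrightarrow> h"
  shows "(\<lambda>N. unstopped (W, H, \<theta>) g N (m N))
           \<longlonglongrightarrow> (wealth_after W H \<theta> g h, H + h, \<theta> - h *\<^sub>R g)"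
proof -
  have err: "(\<lambda>N. fst (unstopped (W, H, \<theta>) g N (m N)) - wealth_after W H \<theta> g (real (m N) / real N))
          \<longlonglongrightarrow> 0"
  proof (rule tendstoI)
    fix e :: real assume "e > 0"
    then have "e / 2 > 0" by simp
    from unstopped_wealth_uniform[OF assms(1) this, of W \<theta> g]
    show "\<forall>\<^sub>F N in sequentially. dist (fst (unstopped (W, H, \<theta>) g N (m N))
            - wealth_after W H \<theta> g (real (m N) / real N)) 0 < e"
    proof (rule eventually_mono)
      fix N
      assume "\<forall>k\<le>N. \<bar>fst (unstopped (W, H, \<theta>) g N k)
                - wealth_after W H \<theta> g (real k / real N)\<bar> \<le> e / 2"
      then have "\<bar>fst (unstopped (W, H, \<theta>) g N (m N))
                - wealth_after W H \<theta> g (real (m N) / real N)\<bar> \<le> e / 2" using m by blast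
      then show "dist (fst (unstopped (W, H, \<theta>) g N (m N))
            - wealth_after W H \<theta> g (real (m N) / real N)) 0 < e"
        using \<open>e > 0\<close> by (simp add: dist_real_def)
    qed
  qed
  have "(\<lambda>N. wealth_after W H \<theta> g (real (m N) / real N)) \<longlonglongrightarrow> wealth_after W H \<theta> g h"
    by (rule isCont_tendsto_compose[OF DERIV_isCont[OF wealth_after_deriv] lim]) fact+
  then have "(\<lambda>N. fst (unstopped (W, H, \<theta>) g N (m N))) \<longlonglongrightarrow> wealth_after W H \<theta> g h"
    using err by (rule Lim_transform)
  moreover have "unstopped (W, H, \<theta>) g N k =
      (fst (unstopped (W, H, \<theta>) g N k), H + real k / real N, \<theta> - (real k / real N) *\<^sub>R g)" for N k
    by (simp add: unstopped_def)
  ultimately show ?thesis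
    by (subst \<open>\<And>k N. unstopped (W, H, \<theta>) g N k = _\<close>) (intro tendsto_intros lim)
qed

section \<open>The limit of one round\<close>

lemma mini_run_tendsto:
  assumes H: "H > 0" and W: "W > 0" and x: "x = cb_point (W, H, \<theta>)" and Fm: "Fm \<le> F x"
    and h: "ereal h = min (phi_zero F Fm x W H \<theta> g) 1"
  shows "(\<lambda>N. mini_run F Fm x g N (W, H, \<theta>))
           \<longlonglongrightarrow> (wealth_after W H \<theta> g h, H + h, \<theta> - h *\<^sub>R g)"
proof (cases "F x = Fm")
  case True
  \<comment> \<open>The round starts on the lower bound: the first zero of \<open>phi\<close> is 0,
    and every mini-update leaves the state unchanged.\<close>
  then have "phi F Fm x W H \<theta> g 0 = 0" using phi_0[OF H, of F Fm W \<theta> g] x by simp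
  then have "phi_zero F Fm x W H \<theta> g \<le> 0"
    unfolding phi_zero_def by (intro Inf_lower) (auto simp: zero_ereal_def)
  then have "phi_zero F Fm x W H \<theta> g = 0" using phi_zero_nonneg by (metis antisym)
  then have "h = 0" using h by (simp add: zero_ereal_def min_def split: if_splits)
  have "mini_update (surrogate F Fm x g) Fm g (1 / real N) (W, H, \<theta>) = (W, H, \<theta>)" for N
    by (rule mini_update_stopped) (simp add: surrogate_def x[symmetric] True)
  then have "(mini_update (surrogate F Fm x g) Fm g (1 / real N) ^^ k) (W, H, \<theta>) = (W, H, \<theta>)"
    for N k by (induction k) simp_all
  then show ?thesis using H by (simp add: mini_run_def \<open>h = 0\<close> wealth_after_0)
next
  case False
  define P where "P = phi F Fm x W H \<theta> g"
  have P0: "P 0 > 0" using False Fm phi_0[OF H, of F Fm W \<theta> g] x by (simp add: P_def)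
  have contP: "A \<subseteq> {0..} \<Longrightarrow> continuous_on A P" for A
    using phi_continuous[OF H] unfolding P_def by (rule continuous_on_subset)
  \<comment> \<open>Strict signs on both sides of h survive a small uniform perturbation. For h = 1
    no sign after h is required, because m/N never exceeds 1.\<close>
  have h01: "0 \<le> h \<and> h \<le> 1 \<and> (\<forall>u. 0 \<le> u \<and> u < h \<longrightarrow> P u > 0)
      \<and> (h < 1 \<longrightarrow> (\<forall>u>h. P u < 0))"
  proof (cases "\<exists>k\<ge>0. P k = 0")
    case True
    then obtain k where k: "k \<ge> 0" "P k = 0" by blast
    obtain z where z: "phi_zero F Fm x W H \<theta> g = ereal z" "0 \<le> z" "P z = 0"
      "\<And>z'. 0 \<le> z' \<Longrightarrow> P z' = 0 \<Longrightarrow> z \<le> z'"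
      using phi_zero_is_zero[OF H k(1) k(2)[unfolded P_def]] unfolding P_def by metis
    have hz: "h = min z 1" using h z(1) by (simp add: one_ereal_def min_def split: if_splits)
    have "P u > 0" if "0 \<le> u" "u < h" for u
      unfolding P_def
    proof (rule phi_pos_before_zero[OF H P0[unfolded P_def] that(1)])
      fix v assume "0 \<le> v" "v \<le> u"
      then show "phi F Fm x W H \<theta> g v \<noteq> 0"
        using z(4)[of v] that(2) hz by (auto simp: P_def)
    qed
    moreover have "P u < 0" if "h < 1" "h < u" for u
      unfolding P_def
      using that z(2,3) P0 hz by (intro phi_neg_after_zero[OF H W _ z(2)]) (auto simp: P_def)
    ultimately show ?thesis using hz z(2) by auto
  next
    case False
    then have "{k. 0 \<le> k \<and> phi F Fm x W H \<theta> g k = 0} = {}"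
      by (auto simp: P_def)
    \<comment> \<open>The infimum of the empty set in \<open>ereal\<close> is \<infinity>, which the
      minimum with 1 truncates.\<close>
    then have "phi_zero F Fm x W H \<theta> g = \<infinity>"
      by (simp only: phi_zero_def image_empty Inf_empty top_ereal_def)
    then have "h = 1" using h by (simp add: one_ereal_def)
    moreover have "P u > 0" if "0 \<le> u" for u
      unfolding P_def using False
      by (intro phi_pos_before_zero[OF H P0[unfolded P_def] that]) (auto simp: P_def)
    ultimately show ?thesis by auto
  qed
  \<comment> \<open>The discrete counterpart of \<open>phi\<close>: the linear branch of the
    surrogate minus \<open>Fm\<close>, so stopping means \<open>Q \<le> 0\<close>.\<close>
  define Q where "Q N k = F x + g \<bullet> (cb_point (unstopped (W, H, \<theta>) g N k) - x) - Fm" for N k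
  have surr: "surrogate F Fm x g (cb_point (unstopped (W, H, \<theta>) g N k)) = Fm \<longleftrightarrow> Q N k \<le> 0"
    for N k by (auto simp: surrogate_def Q_def max_def)
  have "\<exists>m\<le>N. mini_run F Fm x g N (W, H, \<theta>) = unstopped (W, H, \<theta>) g N m \<and>
          (\<forall>j<m. Q N j > 0) \<and> (m < N \<longrightarrow> Q N m \<le> 0)" for N
    using mini_updates_stopping[of N "surrogate F Fm x g" Fm g N "(W, H, \<theta>)"]
    unfolding surr mini_run_def by (simp add: not_le)
  then obtain m where m: "\<And>N. m N \<le> N"
    "\<And>N. mini_run F Fm x g N (W, H, \<theta>) = unstopped (W, H, \<theta>) g N (m N)"
    "\<And>N j. j < m N \<Longrightarrow> Q N j > 0" "\<And>N. m N < N \<Longrightarrow> Q N (m N) \<le> 0"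
    by metis
  have close: "\<forall>\<^sub>F N in sequentially. \<forall>k\<le>N. \<bar>Q N k - P (real k / real N)\<bar> \<le> e" if "e > 0" for e
    using unstopped_phi_uniform[OF H that, where F = F and x = x and Fm = Fm and W = W
        and \<theta> = \<theta> and g = g] by (simp add: Q_def P_def)
  have "(\<lambda>N. real (m N) / real N) \<longlonglongrightarrow> h"
  proof (rule order_tendstoI)
    fix a assume "a < h"
    show "\<forall>\<^sub>F N in sequentially. a < real (m N) / real N"
    proof (cases "a < 0")
      case True
      then show ?thesis
        by (intro always_eventually allI)
           (meson divide_nonneg_nonneg less_le_trans of_nat_0_le_iff)
    next
      case False
      \<comment> \<open>On the compact interval up to a < h, \<open>P\<close> has a positive
        minimum. Once \<open>Q\<close> is within half of it, \<open>Q\<close> cannot be nonpositive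
        there, so no stop occurs by time a.\<close>
      obtain u where u: "u \<in> {0..a}" "\<And>v. v \<in> {0..a} \<Longrightarrow> P u \<le> P v"
        using continuous_attains_inf[of "{0..a}" P] contP[of "{0..a}"] False by auto
      have "P u > 0" using u h01 \<open>a < h\<close> by auto
      then have "P u / 2 > 0" by simp
      show ?thesis
        using close[OF \<open>P u / 2 > 0\<close>] eventually_gt_at_top[of 0]
      proof eventually_elim
        case (elim N)
        show ?case
        proof (rule ccontr)
          assume "\<not> ?case"
          then have r: "real (m N) / real N \<le> a" by simp
          then have "real (m N) / real N < 1" using \<open>a < h\<close> h01 by linarith
          then have "m N < N" using elim(2) by (simp add: divide_less_eq_1)
          then have "Q N (m N) \<le> 0" by (rule m(4))
          moreover have "\<bar>Q N (m N) - P (real (m N) / real N)\<bar> \<le> P u / 2"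
            using elim(1) m(1) by blast
          moreover have "P u \<le> P (real (m N) / real N)" using r by (intro u(2)) auto
          ultimately show False using \<open>P u > 0\<close> by linarith
        qed
      qed
    qed
  next
    fix a assume "h < a"
    show "\<forall>\<^sub>F N in sequentially. real (m N) / real N < a"
    proof (cases "1 < a")
      case True
      then show ?thesis
        using m(1) by (intro always_eventually allI) (metis divide_le_eq_1 le_less_trans of_nat_le_iff
            of_nat_0_le_iff less_le)
    next
      case False
      then have "h < 1" using \<open>h < a\<close> by simp
      \<comment> \<open>A point strictly between h and a leaves room for one step 1/N: if m/N is at
        least a, the preceding index still has time at least b.\<close>
      define b where "b = (h + a) / 2"
      have b: "h < b" "b < a" "b \<le> 1" "0 \<le> b" using \<open>h < a\<close> False h01 by (auto simp: b_def)
      obtain u where u: "u \<in> {b..1}" "\<And>v. v \<in> {b..1} \<Longrightarrow> P v \<le> P u"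
        using continuous_attains_sup[of "{b..1}" P] contP[of "{b..1}"] b by auto
      have "P u < 0" using u h01 b \<open>h < 1\<close> by auto
      then have "- P u / 2 > 0" by simp
      have "\<forall>\<^sub>F N in sequentially. 1 / (a - b) < real N"
        using filterlim_at_top_dense[THEN iffD1, OF filterlim_real_sequentially] by blast
      with close[OF \<open>- P u / 2 > 0\<close>] eventually_gt_at_top[of 0]
      show ?thesis
      proof eventually_elim
        case (elim N)
        show ?case
        proof (rule ccontr)
          assume "\<not> ?case"
          then have r: "a \<le> real (m N) / real N" by simp
          then have "m N \<noteq> 0" using b by (cases "m N = 0") auto
          \<comment> \<open>The index before m is used because \<open>Q\<close> is known to be
            positive only strictly before m; this also covers m = N.\<close>
          then have Q: "Q N (m N - 1) > 0" by (intro m(3)) auto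
          have "real (m N - 1) / real N = real (m N) / real N - 1 / real N"
            using \<open>m N \<noteq> 0\<close> by (simp add: of_nat_diff diff_divide_distrib)
          moreover have "1 / real N < a - b"
            using elim b by (simp add: field_simps)
          ultimately have "b \<le> real (m N - 1) / real N" using r by linarith
          moreover have "real (m N - 1) / real N \<le> 1"
            using m(1)[of N] elim(2) by (simp add: divide_le_eq_1)
          ultimately have "P (real (m N - 1) / real N) \<le> P u" by (intro u(2)) auto
          moreover have "\<bar>Q N (m N - 1) - P (real (m N - 1) / real N)\<bar> \<le> - P u / 2"
            using elim(1) m(1)[of N] by auto
          ultimately show False using Q \<open>P u < 0\<close> by linarith
        qed
      qed
    qed
  qed
  then show ?thesis
    unfolding m(2) using unstopped_tendsto[OF H _ m(1)] h01 by blast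
qed

section \<open>Combining the rounds\<close>

theorem theorem1:
  fixes F :: "'a::euclidean_space \<Rightarrow> real" and Fm :: real and T :: nat
    and x g \<theta> :: "nat \<Rightarrow> 'a" and Wealth H h :: "nat \<Rightarrow> real"
  assumes "1-lipschitz_on UNIV F" and "convex_on UNIV F" and "\<And>y. Fm \<le> F y"
    and "Wealth 1 = 1" and "H 1 = 1" and "\<theta> 1 = 0"
    and "\<And>t. t \<in> {1..T + 1} \<Longrightarrow> x t = cb_point (Wealth t, H t, \<theta> t)"
    and "\<And>t. t \<in> {1..T} \<Longrightarrow> g t \<in> subdifferential F (x t)"
    and "\<And>t. t \<in> {1..T} \<Longrightarrow>
           ereal (h t) = min (phi_zero F Fm (x t) (Wealth t) (H t) (\<theta> t) (g t)) 1"
    and "\<And>t. t \<in> {1..T} \<Longrightarrow> \<theta> (t + 1) = \<theta> t - h t *\<^sub>R g t"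
    and "\<And>t. t \<in> {1..T} \<Longrightarrow> H (t + 1) = H t + h t"
    and "\<And>t. t \<in> {1..T} \<Longrightarrow>
           Wealth (t + 1) = wealth_after (Wealth t) (H t) (\<theta> t) (g t) (h t)"
  shows "\<forall>t\<in>{1..T}.
           (\<lambda>N. mini_run F Fm (x t) (g t) N (Wealth t, H t, \<theta> t))
             \<longlonglongrightarrow> (Wealth (t + 1), H (t + 1), \<theta> (t + 1)) \<and>
           (\<lambda>N. cb_point (mini_run F Fm (x t) (g t) N (Wealth t, H t, \<theta> t)))
             \<longlonglongrightarrow> x (t + 1) \<and>
           x (t + 1) = psi (Wealth t) (H t) (\<theta> t) (g t) (h t)"
proof -
  \<comment> \<open>Positivity, needed to apply \<open>mini_run_tendsto\<close> in each round,
    persists: \<open>h t\<close> is nonnegative as a minimum of nonnegative values, and the wealth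
    is multiplied by an exponential.\<close>
  have inv: "Wealth t > 0 \<and> H t > 0" if "t \<in> {1..T + 1}" for t
  proof -
    have "1 \<le> t" using that by simp
    then show ?thesis using that
    proof (induction t rule: dec_induct)
      case base
      then show ?case using assms(4,5) by simp
    next
      case (step t)
      then have t: "t \<in> {1..T}" by auto
      have "0 \<le> ereal (h t)" unfolding assms(9)[OF t] by (simp add: phi_zero_nonneg)
      moreover have "Wealth t > 0 \<and> H t > 0" using step by auto
      ultimately show ?case
        using assms(11,12)[OF t] by (simp add: wealth_after_pos)
    qed
  qed
  show ?thesis
  proof
    fix t assume t: "t \<in> {1..T}"
    note next_state = assms(10-12)[OF t]
    have lim: "(\<lambda>N. mini_run F Fm (x t) (g t) N (Wealth t, H t, \<theta> t))
        \<longlonglongrightarrow> (Wealth (t + 1), H (t + 1), \<theta> (t + 1))"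
      unfolding next_state
      using t inv[of t] assms(3,7,9) by (intro mini_run_tendsto) auto
    have next_x: "x (t + 1) = cb_point (Wealth (t + 1), H (t + 1), \<theta> (t + 1))"
      using t by (intro assms(7)) auto
    have "H (t + 1) \<noteq> 0" using inv[of "t + 1"] t by auto
    \<comment> \<open>Away from H = 0 the point depends continuously on the state, so the limit of
      states passes to the points.\<close>
    then have "(\<lambda>N. cb_point (mini_run F Fm (x t) (g t) N (Wealth t, H t, \<theta> t)))
        \<longlonglongrightarrow> x (t + 1)"
      unfolding next_x cb_point_def case_prod_beta
      using tendsto_scaleR[OF tendsto_divide[OF tendsto_fst[OF lim]
          tendsto_fst[OF tendsto_snd[OF lim]]] tendsto_snd[OF tendsto_snd[OF lim]]]
      by simp
    moreover have "x (t + 1) = psi (Wealth t) (H t) (\<theta> t) (g t) (h t)"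
      by (simp only: next_x next_state cb_point_def psi_def prod.case)
    ultimately show "(\<lambda>N. mini_run F Fm (x t) (g t) N (Wealth t, H t, \<theta> t))
             \<longlonglongrightarrow> (Wealth (t + 1), H (t + 1), \<theta> (t + 1)) \<and>
           (\<lambda>N. cb_point (mini_run F Fm (x t) (g t) N (Wealth t, H t, \<theta> t)))
             \<longlonglongrightarrow> x (t + 1) \<and>
           x (t + 1) = psi (Wealth t) (H t) (\<theta> t) (g t) (h t)"
      using lim by blast
  qed
qed

end
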